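(* Let $\delta>0$. There exist constants $c,c',\kappa>0$ depending only on $\delta$ such that for any $N\in\mathbb{N}$ there exists a graph $\Gamma$ with $M>N$ vertices such that $$\forall J\subset[M]\qquad |J|\le M/2\ \Rightarrow\ |\partial(J)|-(1-\delta)|\operatorname{Con}(J)|\ge\kappa|J|$$ and $$\mathbb{P}\left(\frac{\det(W)}{\mathbb{E}\det(W)}\le e^{-cM}\right)\ge 1-e^{-c'M},$$ where $W=W(A)$ is the random Gaussian skew-symmetric matrix associated with the adjacency matrix $A$ of $\Gamma$.
   Context: Graphs are finite, simple and undirected, with vertex set $[M]=\{1,\dots,M\}$. For $J\subset[M]$, $\operatorname{Con}(J)$ denotes the set of connected components of (the subgraph induced on) $J$, and $\partial(J)=\{i\in[M]\setminus J:\exists j\in J,\ (i,j)\text{ is an edge}\}$. For the adjacency matrix $A$, $W=W(A)$ is the real skew-symmetric matrix with $W_{ij}=G_{ij}\sqrt{A_{ij}}$ for $i<j$, where $(G_{ij})_{i<j}$ are independent standard normal random variables (so $W_{ji}=-W_{ij}$, $W_{ii}=0$). The ratio $\det(W)/\mathbb{E}\det(W)$ is understood to be well defined, i.e. $\mathbb{E}\det(W)\ne0$. *)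

theory Defs
  imports "HOL-Probability.Probability" "Jordan_Normal_Form.Determinant"
begin

text \<open>
  The vertex set of a graph on \<open>M\<close> vertices is \<open>{..<M}\<close> (rather than \<open>{1..M}\<close>), so that vertices
  are the row and column indices of the matrices of \<^theory>\<open>Jordan_Normal_Form.Matrix\<close>. The edges
  form a symmetric relation: each undirected edge occurs in both orientations.
\<close>

definition simple_graph :: "nat \<Rightarrow> nat rel \<Rightarrow> bool" where
  "simple_graph M E \<longleftrightarrow> E \<subseteq> {..<M} \<times> {..<M} \<and> sym E \<and> irrefl E"

definition graph_components :: "nat rel \<Rightarrow> nat set \<Rightarrow> nat set set" where
  "graph_components E J = J // {(u, v) \<in> J \<times> J. (u, v) \<in> (E \<inter> J \<times> J)\<^sup>*}"

definition vertex_boundary :: "nat \<Rightarrow> nat rel \<Rightarrow> nat set \<Rightarrow> nat set" where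
  "vertex_boundary M E J = {i \<in> {..<M} - J. \<exists>j\<in>J. (i, j) \<in> E}"

definition adjacency_matrix :: "nat \<Rightarrow> nat rel \<Rightarrow> real mat" where
  "adjacency_matrix M E = Matrix.mat M M (\<lambda>(i, j). if (i, j) \<in> E then 1 else 0)"

text \<open>
  The random variables \<open>G\<^sub>i\<^sub>j\<close> with \<open>i < j\<close> are the coordinates of a point \<open>G\<close> of the product
  space \<open>gaussian_space M\<close>. Only these coordinates occur in the matrix below.
\<close>

definition gaussian_space :: "nat \<Rightarrow> (nat \<times> nat \<Rightarrow> real) measure" where
  "gaussian_space M = (\<Pi>\<^sub>M p\<in>{(i, j). i < j \<and> j < M}. std_normal_distribution)"

definition skew_matrix :: "real mat \<Rightarrow> (nat \<times> nat \<Rightarrow> real) \<Rightarrow> real mat" where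
  "skew_matrix A G = Matrix.mat (dim_row A) (dim_row A) (\<lambda>(i, j).
     if i < j then G (i, j) * sqrt (A $$ (i, j))
     else if j < i then - (G (j, i) * sqrt (A $$ (j, i)))
     else 0)"

definition det_W :: "nat \<Rightarrow> nat rel \<Rightarrow> (nat \<times> nat \<Rightarrow> real) \<Rightarrow> real" where
  "det_W M E G = Determinant.det (skew_matrix (adjacency_matrix M E) G)"

text \<open>The expectation of \<open>det W\<close>; the Bochner integral is \<open>0\<close> for a non-integrable function.\<close>

definition expected_det_W :: "nat \<Rightarrow> nat rel \<Rightarrow> real" where
  "expected_det_W M E = (\<integral>G. det_W M E G \<partial>gaussian_space M)"

end

theory Submission
  imports Defs
begin

text \<open>
  The graph is the \<^emph>\<open>pendant clique\<close> on \<open>M = 2n\<close> vertices: a complete graph on a core \<open>{..<n}\<close>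
  in which every core vertex \<open>i\<close> carries one extra neighbour, the leaf \<open>n + i\<close>. It has exactly one
  perfect matching, the set of the \<open>n\<close> pendant edges. Accordingly only these edges enter the
  determinant, and \<open>det W\<close> is the product of \<open>n\<close> independent squared standard normal variables
  (\<open>det_W_pendant_clique\<close>). Its expectation is \<open>1\<close>, but by Jensen's inequality its typical size is
  exponentially smaller: the square root of \<open>det W\<close> has expectation \<open>q\<^sup>n\<close> with
  \<open>q = sqrt (2 / \<pi>) < 1\<close>, so that Markov's inequality gives the upper tail bound.

  As to expansion, a set of \<open>s\<close> leaves has \<open>s\<close> components and \<open>s\<close> boundary vertices, and its surplus
  \<open>\<delta> s\<close> is exactly what the factor \<open>1 - \<delta>\<close> grants. As soon as a set contains a core vertex, the whole remaining core belongs
  to its boundary, while all of the set except for the leaves without their core vertex forms a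
  single component (\<open>pendant_clique_expansion\<close>).
\<close>

section \<open>The pendant clique and its expansion\<close>

definition pendant_clique :: "nat \<Rightarrow> nat rel" where
  "pendant_clique n = {(i, j). i < n \<and> j < n \<and> i \<noteq> j} \<union>
     {(i, n + i) | i. i < n} \<union> {(n + i, i) | i. i < n}"

lemma simple_graph_pendant_clique: "simple_graph (2 * n) (pendant_clique n)"
  by (auto simp: simple_graph_def pendant_clique_def sym_def irrefl_def)

lemma card_quotient_le_card_representatives:
  assumes "equiv A r" "finite X" "\<And>a. a \<in> A \<Longrightarrow> \<exists>x\<in>X. (a, x) \<in> r"
  shows "card (A // r) \<le> card X"
proof -
  have "A // r \<subseteq> (\<lambda>x. r `` {x}) ` X"
    using assms(3) equiv_class_eq[OF assms(1)] by (fastforce simp: quotient_def)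
  then have "card (A // r) \<le> card ((\<lambda>x. r `` {x}) ` X)"
    using assms(2) by (intro card_mono) auto
  also have "\<dots> \<le> card X"
    using assms(2) by (rule card_image_le)
  finally show ?thesis .
qed

lemma equiv_connected_within:
  assumes "sym E"
  shows "equiv J {(u, v) \<in> J \<times> J. (u, v) \<in> (E \<inter> J \<times> J)\<^sup>*}"
proof -
  have "sym (E \<inter> J \<times> J)"
    using assms by (auto simp: sym_def)
  then have "sym ((E \<inter> J \<times> J)\<^sup>*)"
    by (rule sym_rtrancl)
  then show ?thesis
    by (auto simp: equiv_def refl_on_def sym_def trans_def intro: rtrancl_trans)
qed

lemma card_components_le_card_representatives:
  assumes "sym E" "finite X" "X \<subseteq> J"
    and "\<And>u. u \<in> J \<Longrightarrow> \<exists>x\<in>X. (u, x) \<in> (E \<inter> J \<times> J)\<^sup>*"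
  shows "card (graph_components E J) \<le> card X"
  unfolding graph_components_def
  using assms by (intro card_quotient_le_card_representatives equiv_connected_within) blast+

text \<open>
  Every vertex set consists of a set \<open>T\<close> of core vertices and of the leaves attached to a set \<open>S\<close>
  of core vertices. If \<open>T\<close> is nonempty, one core vertex represents the component of all of \<open>T\<close>
  and of the leaves attached to \<open>T\<close>; each leaf attached to \<open>S - T\<close> is isolated.
\<close>

lemma card_components_pendant_clique_le:
  fixes n :: nat and S T :: "nat set"
  assumes "S \<subseteq> {..<n}" "T \<subseteq> {..<n}" "T \<noteq> {}"
  shows "card (graph_components (pendant_clique n) (T \<union> (+) n ` S)) \<le> 1 + card (S - T)"
proof -
  let ?J = "T \<union> (+) n ` S"
  let ?E = "pendant_clique n \<inter> ?J \<times> ?J"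
  obtain t where t: "t \<in> T"
    using assms(3) by blast
  have fin: "finite S" "finite T"
    using assms finite_subset by auto
  have core: "(i, t) \<in> ?E\<^sup>*" if "i \<in> T" for i
  proof (cases "i = t")
    case False
    then have "(i, t) \<in> ?E"
      using that t assms by (auto simp: pendant_clique_def)
    then show ?thesis ..
  qed simp
  have leaf: "(n + i, t) \<in> ?E\<^sup>*" if "i \<in> S" "i \<in> T" for i
  proof -
    have "(n + i, i) \<in> ?E"
      using that assms by (auto simp: pendant_clique_def)
    then show ?thesis
      using core[OF \<open>i \<in> T\<close>] by (rule converse_rtrancl_into_rtrancl)
  qed
  have "card (graph_components (pendant_clique n) ?J) \<le> card (insert t ((+) n ` (S - T)))"
  proof (rule card_components_le_card_representatives)
    show "sym (pendant_clique n)"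
      using simple_graph_pendant_clique by (simp add: simple_graph_def)
    show "finite (insert t ((+) n ` (S - T)))"
      using fin by simp
    show "insert t ((+) n ` (S - T)) \<subseteq> ?J"
      using t by auto
    show "\<exists>x\<in>insert t ((+) n ` (S - T)). (u, x) \<in> ?E\<^sup>*" if "u \<in> ?J" for u
      using that core leaf by blast
  qed
  also have "\<dots> \<le> Suc (card ((+) n ` (S - T)))"
    by (rule card_insert_le_m1) simp_all
  also have "\<dots> \<le> 1 + card (S - T)"
    using card_image_le[of "S - T" "(+) n"] fin by simp
  finally show ?thesis .
qed

lemma card_vertex_boundary_pendant_clique_ge:
  assumes "S \<subseteq> {..<n}" "T \<subseteq> {..<n}" "T \<noteq> {}"
  shows "n + card (T - S) \<le> card (vertex_boundary (2 * n) (pendant_clique n) (T \<union> (+) n ` S)) + card T"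
proof -
  let ?B = "vertex_boundary (2 * n) (pendant_clique n) (T \<union> (+) n ` S)"
  have fin: "finite S" "finite T"
    using assms finite_subset by auto
  have "({..<n} - T) \<union> (+) n ` (T - S) \<subseteq> ?B"
    using assms by (fastforce simp: vertex_boundary_def pendant_clique_def)
  then have "card (({..<n} - T) \<union> (+) n ` (T - S)) \<le> card ?B"
    by (intro card_mono) (auto simp: vertex_boundary_def)
  moreover have "card (({..<n} - T) \<union> (+) n ` (T - S)) = card ({..<n} - T) + card (T - S)"
    using fin by (subst card_Un_disjoint) (auto simp: card_image)
  moreover have "card ({..<n} - T) = n - card T" "card T \<le> n"
    using assms fin card_mono[of "{..<n}" T] by (auto simp: card_Diff_subset)
  ultimately show ?thesis
    by simp
qed

text \<open>
  For a set of leaves the right-hand side is only \<open>\<delta>\<close> times its size. The factor \<open>1 / 2\<close> accounts for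
  pairs of a core vertex and its leaf: \<open>v\<close> of them form a set of size \<open>2v\<close> with \<open>n - v\<close> boundary
  vertices, which for \<open>2v = n\<close> is half of its size. A single pair with \<open>n = 2\<close> attains equality.
\<close>

lemma pendant_clique_expansion:
  fixes \<delta> :: real
  assumes \<delta>: "0 < \<delta>" "\<delta> \<le> 1"
    and J: "J \<subseteq> {..<2 * n}" "card J \<le> n"
  shows "\<delta> / 2 * card J \<le> card (vertex_boundary (2 * n) (pendant_clique n) J)
    - (1 - \<delta>) * card (graph_components (pendant_clique n) J)"
proof -
  define T where "T = J \<inter> {..<n}"
  define S where "S = {i \<in> {..<n}. n + i \<in> J}"
  have sub: "S \<subseteq> {..<n}" "T \<subseteq> {..<n}" and fin: "finite S" "finite T"
    by (auto simp: S_def T_def)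
  have J_eq: "J = T \<union> (+) n ` S"
  proof (intro equalityI subsetI)
    fix u assume "u \<in> J"
    show "u \<in> T \<union> (+) n ` S"
    proof (cases "u < n")
      case False
      then have "u = n + (u - n)" "u - n \<in> S"
        using \<open>u \<in> J\<close> J by (auto simp: S_def)
      then show ?thesis
        by blast
    qed (use \<open>u \<in> J\<close> in \<open>simp add: T_def\<close>)
  qed (auto simp: S_def T_def)
  have card_J: "card J = card T + card S"
    unfolding J_eq using fin by (subst card_Un_disjoint) (auto simp: card_image T_def)
  let ?b = "card (vertex_boundary (2 * n) (pendant_clique n) J)"
  let ?k = "card (graph_components (pendant_clique n) J)"
  show ?thesis
  proof (cases "T = {}")
    case True
    have "S \<subseteq> vertex_boundary (2 * n) (pendant_clique n) J"
      unfolding J_eq using True by (auto simp: vertex_boundary_def pendant_clique_def S_def)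
    then have "card S \<le> ?b"
      by (intro card_mono) (auto simp: vertex_boundary_def)
    moreover have "?k \<le> card J"
      using simple_graph_pendant_clique J_eq fin
      by (intro card_components_le_card_representatives) (auto simp: simple_graph_def)
    then have "(1 - \<delta>) * ?k \<le> (1 - \<delta>) * card J"
      using \<delta> by (intro mult_left_mono) auto
    moreover have "card J = card S"
      using card_J True by simp
    moreover have "0 \<le> \<delta> * card S"
      using \<delta> by simp
    ultimately show ?thesis
      by (simp add: algebra_simps)
  next
    case False
    define s u v where "s = card (S - T)" and "u = card (T - S)" and "v = card (S \<inter> T)"
    have S: "card S = s + v" and T: "card T = u + v"
      using card_Diff_subset_Int[of S T] card_Diff_subset_Int[of T S] fin
        card_mono[of S "S \<inter> T"] card_mono[of T "S \<inter> T"]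
      by (auto simp: s_def u_def v_def Int_commute)
    have "?k \<le> 1 + s"
      using card_components_pendant_clique_le[OF sub False] by (simp add: J_eq s_def)
    then have k: "(1 - \<delta>) * ?k \<le> (1 - \<delta>) * (1 + s)"
      using \<delta> by (intro mult_left_mono) auto
    have "n + u \<le> ?b + (u + v)"
      using card_vertex_boundary_pendant_clique_ge[OF sub False] T by (simp add: J_eq u_def)
    moreover have "s + u + 2 * v \<le> n"
      using J card_J S T by simp
    ultimately have b: "real s + u + v \<le> ?b"
      by linarith
    have "1 \<le> u + v"
      using False fin T by (metis One_nat_def Suc_leI card_gt_0_iff)
    then have "0 \<le> (1 - \<delta>) * (real u + v - 1)"
      using \<delta> by (intro mult_nonneg_nonneg) auto
    moreover have "0 \<le> \<delta> * s" "0 \<le> \<delta> * u"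
      using \<delta> by simp_all
    moreover have "real (card J) = s + u + 2 * v"
      using card_J S T by simp
    ultimately show ?thesis
      using k b by (simp add: algebra_simps)
  qed
qed

section \<open>The determinant\<close>

text \<open>
  With the core vertices first, the matrix has the block form \<open>((K, D), (- D, 0))\<close> with \<open>D\<close>
  diagonal and a zero block between the leaves. The lower two blocks commute, hence the determinant
  is that of \<open>K 0 + D D\<close> and the clique block \<open>K\<close> drops out.
\<close>

lemma det_W_pendant_clique:
  "det_W (2 * n) (pendant_clique n) G = (\<Prod>i<n. G (i, n + i))\<^sup>2"
proof -
  define D :: "real mat" where
    "D = Matrix.mat n n (\<lambda>(i, j). if i = j then G (i, n + i) else 0)"
  define W where "W = skew_matrix (adjacency_matrix (2 * n) (pendant_clique n)) G"
  define K where "K = Matrix.mat n n (\<lambda>ij. W $$ ij)"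
  have D: "D \<in> carrier_mat n n" and K: "K \<in> carrier_mat n n"
    by (simp_all add: D_def K_def)
  have "W = four_block_mat K D (- D) (0\<^sub>m n n)"
  proof (rule eq_matI)
    fix i j assume ij: "i < dim_row (four_block_mat K D (- D) (0\<^sub>m n n))"
      "j < dim_col (four_block_mat K D (- D) (0\<^sub>m n n))"
    then have "i < 2 * n" "j < 2 * n"
      by (simp_all add: K_def)
    then show "W $$ (i, j) = four_block_mat K D (- D) (0\<^sub>m n n) $$ (i, j)"
      by (cases "i < n"; cases "j < n")
        (auto simp: K_def D_def W_def skew_matrix_def adjacency_matrix_def pendant_clique_def)
  qed (simp_all add: W_def K_def skew_matrix_def adjacency_matrix_def)
  then have "Determinant.det W = Determinant.det (four_block_mat K D (- D) (0\<^sub>m n n))"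
    by simp
  also have "\<dots> = Determinant.det (K * 0\<^sub>m n n - D * (- D))"
    using D K by (intro det_four_block_mat) auto
  also have "K * 0\<^sub>m n n - D * (- D) = D * D"
    using D K by (intro eq_matI) auto
  also have "Determinant.det (D * D) = (Determinant.det D)\<^sup>2"
    using D by (simp add: det_mult power2_eq_square)
  also have "Determinant.det D = (\<Prod>i<n. G (i, n + i))"
    using D by (subst det_lower_triangular[of n])
      (auto simp: D_def prod_list_diag_prod atLeast0LessThan)
  finally show ?thesis
    by (simp add: det_W_def W_def)
qed

section \<open>Products of independent Gaussian variables\<close>

lemma prob_space_gaussian_space: "prob_space (gaussian_space M)"
  unfolding gaussian_space_def by (intro prob_space_PiM prob_space_normal_density) simp

lemma has_bochner_integral_gaussian_space_prod:
  fixes h :: "real \<Rightarrow> real"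
  assumes h: "has_bochner_integral std_normal_distribution h m"
    and S: "S \<subseteq> {(i, j). i < j \<and> j < M}"
  shows "has_bochner_integral (gaussian_space M) (\<lambda>G. \<Prod>p\<in>S. h (G p)) (m ^ card S)"
proof -
  interpret std: prob_space std_normal_distribution
    by (rule prob_space_normal_density) simp
  interpret product_sigma_finite "\<lambda>_ :: nat \<times> nat. std_normal_distribution"
    by standard
  let ?I = "{(i, j). i < j \<and> j < M}"
  have fin: "finite ?I"
    by (rule finite_subset[of _ "{..<M} \<times> {..<M}"]) auto
  (* Coordinates outside S get the constant factor 1, which integrates to 1. *)
  let ?f = "\<lambda>p. if p \<in> S then h else (\<lambda>_. 1)"
  have int: "integrable std_normal_distribution (?f p)" for p
    using h by (auto simp: has_bochner_integral_iff)
  have f: "(\<Prod>p\<in>?I. ?f p (G p)) = (\<Prod>p\<in>S. h (G p))" for G :: "nat \<times> nat \<Rightarrow> real"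
    using S fin by (intro prod.mono_neutral_cong_right) auto
  have "(\<Prod>p\<in>?I. integral\<^sup>L std_normal_distribution (?f p)) = (\<Prod>p\<in>S. m)"
    using S fin h std.prob_space
    by (intro prod.mono_neutral_cong_right) (auto simp: has_bochner_integral_iff)
  then show ?thesis
    using product_integrable_prod[OF fin, of ?f] product_integral_prod[OF fin, of ?f] int
    by (simp add: has_bochner_integral_iff gaussian_space_def f)
qed

lemma has_bochner_integral_pendant_edges_prod:
  fixes h :: "real \<Rightarrow> real"
  assumes "has_bochner_integral std_normal_distribution h m"
  shows "has_bochner_integral (gaussian_space (2 * n)) (\<lambda>G. \<Prod>i<n. h (G (i, n + i))) (m ^ n)"
proof -
  have inj: "inj_on (\<lambda>i. (i, n + i)) {..<n}"
    by (auto simp: inj_on_def)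
  have "(\<lambda>i. (i, n + i)) ` {..<n} \<subseteq> {(i, j). i < j \<and> j < 2 * n}"
    by auto
  from has_bochner_integral_gaussian_space_prod[OF assms this] show ?thesis
    by (simp add: prod.reindex[OF inj] card_image[OF inj])
qed

lemma std_normal_has_second_moment:
  "has_bochner_integral std_normal_distribution (\<lambda>x. x\<^sup>2) 1"
  using std_normal_moment_even[of 1]
  by (auto simp: has_bochner_integral_iff integrable_density integral_density)

lemma std_normal_has_abs_moment:
  "has_bochner_integral std_normal_distribution (\<lambda>x. \<bar>x\<bar>) (sqrt (2 / pi))"
  using std_normal_moment_abs_odd[of 0]
  by (auto simp: has_bochner_integral_iff integrable_density integral_density)

lemma expected_det_W_pendant_clique: "expected_det_W (2 * n) (pendant_clique n) = 1"
  using has_bochner_integral_pendant_edges_prod[OF std_normal_has_second_moment, of n]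
  by (simp add: expected_det_W_def det_W_pendant_clique prod_power_distrib has_bochner_integral_iff)

text \<open>
  Markov's inequality is applied to the square root of the determinant: \<open>det W\<close> itself has mean
  \<open>1\<close>, so for it the inequality is void at thresholds below \<open>1\<close>.
\<close>

lemma det_W_pendant_clique_tail:
  fixes \<epsilon> :: real
  assumes "0 < \<epsilon>"
  shows "\<P>(G in gaussian_space (2 * n). det_W (2 * n) (pendant_clique n) G \<le> \<epsilon>\<^sup>2)
    \<ge> 1 - sqrt (2 / pi) ^ n / \<epsilon>"
proof -
  let ?P = "gaussian_space (2 * n)"
  interpret prob_space ?P
    by (rule prob_space_gaussian_space)
  let ?X = "\<lambda>G :: nat \<times> nat \<Rightarrow> real. \<Prod>i<n. \<bar>G (i, n + i)\<bar>"
  have X: "integrable ?P ?X" "integral\<^sup>L ?P ?X = sqrt (2 / pi) ^ n"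
    using has_bochner_integral_pendant_edges_prod[OF std_normal_has_abs_moment, of n]
    by (simp_all add: has_bochner_integral_iff)
  note [measurable] = borel_measurable_integrable[OF X(1)]
  have det: "det_W (2 * n) (pendant_clique n) G = (?X G)\<^sup>2" for G
    by (simp add: det_W_pendant_clique flip: abs_prod)
  let ?B = "{G \<in> space ?P. \<epsilon> \<le> ?X G}"
  have "prob ?B \<le> sqrt (2 / pi) ^ n / \<epsilon>"
    using integral_Markov_inequality_measure[OF X(1) sets.empty_sets, of \<epsilon>] assms X(2)
    by (simp add: prod_nonneg)
  then have "1 - sqrt (2 / pi) ^ n / \<epsilon> \<le> 1 - prob ?B"
    by simp
  also have "\<dots> = prob (space ?P - ?B)"
    by (rule prob_compl[symmetric]) measurable
  also have "\<dots> \<le> prob {G \<in> space ?P. (?X G)\<^sup>2 \<le> \<epsilon>\<^sup>2}"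
  proof (rule finite_measure_mono)
    show "space ?P - ?B \<subseteq> {G \<in> space ?P. (?X G)\<^sup>2 \<le> \<epsilon>\<^sup>2}"
      by (auto intro!: power_mono prod_nonneg)
  qed measurable
  finally show ?thesis
    by (simp only: det)
qed

section \<open>Expansion without concentration of the determinant\<close>

theorem proposition1p7:
  fixes \<delta> :: real
  assumes "\<delta> > 0"
  shows "\<exists>c c' \<kappa> :: real. c > 0 \<and> c' > 0 \<and> \<kappa> > 0 \<and>
    (\<forall>N::nat. \<exists>(M::nat) E. M > N \<and> simple_graph M E \<and>
      (\<forall>J. J \<subseteq> {..<M} \<and> real (card J) \<le> real M / 2 \<longrightarrow>
         real (card (vertex_boundary M E J)) - (1 - \<delta>) * real (card (graph_components E J))
           \<ge> \<kappa> * real (card J)) \<and>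
      expected_det_W M E \<noteq> 0 \<and>
      \<P>(G in gaussian_space M. det_W M E G / expected_det_W M E \<le> exp (- c * real M))
        \<ge> 1 - exp (- c' * real M))"
proof -
  define d where "d = min \<delta> 1"
  have d: "0 < d" "d \<le> 1" "d \<le> \<delta>"
    using assms by (auto simp: d_def)
  define a where "a = - ln (sqrt (2 / pi))"
  have "sqrt (2 / pi) < 1"
    using pi_gt3 by simp
  then have a: "0 < a" and exp_a: "sqrt (2 / pi) = exp (- a)"
    by (simp_all add: a_def ln_less_zero)
  have expansion: "real (card (vertex_boundary (2 * n) (pendant_clique n) J))
      - (1 - \<delta>) * real (card (graph_components (pendant_clique n) J)) \<ge> d / 2 * real (card J)"
    if "J \<subseteq> {..<2 * n}" "real (card J) \<le> real (2 * n) / 2" for n J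
  proof -
    have "(1 - \<delta>) * card (graph_components (pendant_clique n) J)
        \<le> (1 - d) * card (graph_components (pendant_clique n) J)"
      using d by (intro mult_right_mono) auto
    then show ?thesis
      using pendant_clique_expansion[OF d(1,2) that(1)] that(2) by simp
  qed
  have tail: "\<P>(G in gaussian_space (2 * n). det_W (2 * n) (pendant_clique n) G
        / expected_det_W (2 * n) (pendant_clique n) \<le> exp (- (a / 2) * real (2 * n)))
      \<ge> 1 - exp (- (a / 4) * real (2 * n))" for n
  proof -
    (* The threshold is the geometric mean of 1 and the expectation exp (- a * n) of the square
       root of the determinant, so that half of the exponential gap is left for the tail. *)
    let ?\<epsilon> = "exp (- (a / 2) * n)"
    have "?\<epsilon>\<^sup>2 = exp (- (a / 2) * real (2 * n))"
      by (simp flip: exp_double)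
    moreover have "sqrt (2 / pi) ^ n / ?\<epsilon> = exp (- (a / 4) * real (2 * n))"
      by (simp add: exp_a flip: exp_of_nat_mult exp_diff)
    ultimately show ?thesis
      using det_W_pendant_clique_tail[of ?\<epsilon> n] by (simp add: expected_det_W_pendant_clique)
  qed
  show ?thesis
  proof (rule exI[of _ "a / 2"], rule exI[of _ "a / 4"], rule exI[of _ "d / 2"],
      intro conjI allI)
    fix N :: nat
    show "\<exists>M E. N < M \<and> simple_graph M E \<and>
      (\<forall>J. J \<subseteq> {..<M} \<and> real (card J) \<le> real M / 2 \<longrightarrow>
         real (card (vertex_boundary M E J)) - (1 - \<delta>) * real (card (graph_components E J))
           \<ge> d / 2 * real (card J)) \<and>
      expected_det_W M E \<noteq> 0 \<and>
      \<P>(G in gaussian_space M. det_W M E G / expected_det_W M E \<le> exp (- (a / 2) * real M))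
        \<ge> 1 - exp (- (a / 4) * real M)"
    proof (rule exI[of _ "2 * (N + 1)"], rule exI[of _ "pendant_clique (N + 1)"],
        intro conjI allI impI simple_graph_pendant_clique tail)
      show "expected_det_W (2 * (N + 1)) (pendant_clique (N + 1)) \<noteq> 0"
        by (simp only: expected_det_W_pendant_clique one_neq_zero not_False_eq_True)
    qed (simp, elim conjE, rule expansion)
  qed (use a d in auto)
qed

end
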